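(* In the payment network creation game with $n$ players, betweenness weight $b\ge 0$ and closeness weight $c>0$ with $c+b\ge\frac{1}{n^2}$ and $c<1$, the price of anarchy is $\mathrm{PoA}=\mathcal{O}(n)$; i.e., there is an absolute constant $C$ such that $\mathrm{PoA}\le C\,n$ for all $n$, $b$, $c$ satisfying these conditions.
   Context: Payment network creation game. There are $n\ge 2$ players $[n]=\{0,1,\dots,n-1\}$. A strategy of player $u$ is a set $s_u\subseteq [n]\setminus\{u\}$ (the players to whom $u$ opens a channel). A strategy combination is $s=(s_0,\dots,s_{n-1})$, and $G[s]$ is the undirected simple graph on $[n]$ in which $u,v$ are adjacent iff $v\in s_u$ or $u\in s_v$. With weights $b\ge 0$ and $c>0$, the cost of $u$ is $$\mathrm{cost}_u(s)=|s_u|+b\cdot \mathrm{betweenness}_u(s)+c\cdot \mathrm{closeness}_u(s),$$ $$\mathrm{betweenness}_u(s)=(n-1)(n-2)-\sum_{\substack{(i,j)\in[n]^2:\ i\ne j,\ i\neq u,\ j\ne u,\\ m(i,j)>0}}\frac{m_u(i,j)}{m(i,j)},\qquad \mathrm{closeness}_u(s)=\sum_{v\in[n]\setminus\{u\}}\bigl(d_{G[s]}(u,v)-1\bigr).$$ The sum in the betweenness runs over ordered pairs; $m(i,j)$ is the number of shortest paths between $i$ and $j$ in $G[s]$ and $m_u(i,j)$ the number of those passing through $u$; $d_{G[s]}$ is graph distance, equal to $\infty$ between different components. The social cost is $\mathrm{cost}(s)=\sum_{u}\mathrm{cost}_u(s)$. A strategy combination is a Nash equilibrium if no player can strictly decrease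 her cost by unilaterally changing her strategy; equilibrium graphs are taken to be connected (a player's cost is infinite in a disconnected graph, and disconnected strategy combinations are not regarded as equilibria). With $S$ the set of all strategy combinations and $N$ the set of Nash equilibria, $\mathrm{PoA}=\dfrac{\max_{s\in N}\mathrm{cost}(s)}{\min_{s\in S}\mathrm{cost}(s)}$; an upper bound on $\mathrm{PoA}$ means that bound for the ratio $\mathrm{cost}(s)/\min_{s'\in S}\mathrm{cost}(s')$ for every $s\in N$. *)

theory Defs
  imports "Graph_Theory.Graph_Theory"
begin

text \<open>Strategy combinations are extensional functions, so that for each \<open>n\<close> there are only
  finitely many of them and each one is determined by its values on the players \<open>{..<n}\<close>.\<close>

type_synonym strategy_comb = "nat \<Rightarrow> nat set"

definition strategy_set :: "nat \<Rightarrow> nat \<Rightarrow> nat set set" where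
  "strategy_set n u = Pow ({..<n} - {u})"

definition strategy_combs :: "nat \<Rightarrow> strategy_comb set" where
  "strategy_combs n = (\<Pi>\<^sub>E u\<in>{..<n}. strategy_set n u)"

text \<open>Undirected simple graphs are the symmetric loop-free digraphs without parallel arcs
  (locale \<open>pair_graph\<close>).\<close>

definition channel_graph :: "nat \<Rightarrow> strategy_comb \<Rightarrow> (nat, nat \<times> nat) pre_digraph" where
  "channel_graph n s = with_proj
     \<lparr> pverts = {..<n}, parcs = {(u, v). u < n \<and> v < n \<and> (v \<in> s u \<or> u \<in> s v)} \<rparr>"

lemma pair_graph_channel_graph:
  assumes "s \<in> strategy_combs n"
  shows "pair_graph
     \<lparr> pverts = {..<n}, parcs = {(u, v). u < n \<and> v < n \<and> (v \<in> s u \<or> u \<in> s v)} \<rparr>"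
proof -
  have "finite {(u, v). u < n \<and> v < n \<and> (v \<in> s u \<or> u \<in> s v)}"
    by (rule finite_subset[of _ "{..<n} \<times> {..<n}"]) auto
  moreover have "u \<notin> s u" if "u < n" for u
    using assms that by (auto simp: strategy_combs_def strategy_set_def PiE_iff)
  ultimately show ?thesis
    by unfold_locales (auto simp: symmetric_def sym_def)
qed

lemma wf_digraph_channel_graph: "wf_digraph (channel_graph n s)"
  by unfold_locales (auto simp: channel_graph_def)

lemma finite_strategy_combs: "finite (strategy_combs n)"
  by (auto simp: strategy_combs_def strategy_set_def intro: finite_PiE)

definition graph_dist :: "('a, 'b) pre_digraph \<Rightarrow> 'a \<Rightarrow> 'a \<Rightarrow> ereal" where
  "graph_dist G u v = wf_digraph.\<mu> G (\<lambda>_. 1) u v"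

definition shortest_paths :: "('a, 'b) pre_digraph \<Rightarrow> 'a \<Rightarrow> 'a \<Rightarrow> 'b awalk set" where
  "shortest_paths G i j =
     {p. pre_digraph.apath G i p j \<and> ereal (real (length p)) = graph_dist G i j}"

definition shortest_paths_via ::
  "('a, 'b) pre_digraph \<Rightarrow> 'a \<Rightarrow> 'a \<Rightarrow> 'a \<Rightarrow> 'b awalk set" where
  "shortest_paths_via G u i j =
     {p \<in> shortest_paths G i j. u \<in> set (pre_digraph.awalk_verts G i p)}"

definition betweenness :: "nat \<Rightarrow> strategy_comb \<Rightarrow> nat \<Rightarrow> real" where
  "betweenness n s u = (real n - 1) * (real n - 2) -
     (\<Sum>(i, j) \<in> {(i, j). i < n \<and> j < n \<and> i \<noteq> j \<and> i \<noteq> u \<and> j \<noteq> u \<and>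
                       card (shortest_paths (channel_graph n s) i j) > 0}.
        real (card (shortest_paths_via (channel_graph n s) u i j)) /
        real (card (shortest_paths (channel_graph n s) i j)))"

definition closeness :: "nat \<Rightarrow> strategy_comb \<Rightarrow> nat \<Rightarrow> ereal" where
  "closeness n s u = (\<Sum>v\<in>{..<n} - {u}. graph_dist (channel_graph n s) u v - 1)"

text \<open>For \<open>c > 0\<close> and \<open>n \<ge> 2\<close> this is \<open>\<infinity>\<close> exactly when the channel graph is disconnected.\<close>

definition player_cost :: "nat \<Rightarrow> real \<Rightarrow> real \<Rightarrow> strategy_comb \<Rightarrow> nat \<Rightarrow> ereal" where
  "player_cost n b c s u =
     ereal (real (card (s u))) + ereal (b * betweenness n s u) + ereal c * closeness n s u"

definition social_cost :: "nat \<Rightarrow> real \<Rightarrow> real \<Rightarrow> strategy_comb \<Rightarrow> ereal" where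
  "social_cost n b c s = (\<Sum>u<n. player_cost n b c s u)"

text \<open>The qualified name avoids the topological notion \<open>connected\<close>.\<close>

definition nash_equilibria :: "nat \<Rightarrow> real \<Rightarrow> real \<Rightarrow> strategy_comb set" where
  "nash_equilibria n b c =
     {s \<in> strategy_combs n. Digraph_Component.connected (channel_graph n s) \<and>
        (\<forall>u<n. \<forall>t\<in>strategy_set n u.
           \<not> player_cost n b c (s(u := t)) u < player_cost n b c s u)}"

definition social_optimum :: "nat \<Rightarrow> real \<Rightarrow> real \<Rightarrow> ereal" where
  "social_optimum n b c = Min (social_cost n b c ` strategy_combs n)"

text \<open>The set of equilibria is finite, so the supremum is the maximum whenever an equilibrium
  exists. If there is none, it is \<open>-\<infinity>\<close> and every upper bound holds vacuously.\<close>

definition price_of_anarchy :: "nat \<Rightarrow> real \<Rightarrow> real \<Rightarrow> ereal" where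
  "price_of_anarchy n b c =
     (SUP s\<in>nash_equilibria n b c. social_cost n b c s / social_optimum n b c)"

end

theory Submission
  imports Defs
begin

text \<open>By opening a channel to everybody, a player pays at most
  \<open>(n - 1) + b (n - 1) (n - 2)\<close>; hence at an equilibrium nobody pays more and the social cost is at
  most \<open>n\<close> times this amount. Conversely, let \<open>s\<close> be any strategy combination of finite cost.
  Every player then has a neighbour, so there are at least \<open>n\<close> ordered adjacent pairs. They force at
  least \<open>n / 2\<close> opened channels. Moreover no third player lies on a shortest path between adjacent
  players, so each such pair contributes \<open>1\<close> to the betweenness cost of each of the other \<open>n - 2\<close>
  players. Thus the optimum is at least \<open>n / 2 + b n (n - 2)\<close>, and the ratio is at most \<open>2 n\<close>.\<close>

section \<open>Arcs, walks and distances in the channel graph\<close>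

definition channel_arcs :: "nat \<Rightarrow> strategy_comb \<Rightarrow> (nat \<times> nat) set" where
  "channel_arcs n s = {(u, v). u < n \<and> v < n \<and> (v \<in> s u \<or> u \<in> s v)}"

lemma channel_graph_simps [simp]:
  "verts (channel_graph n s) = {..<n}"
  "arcs (channel_graph n s) = channel_arcs n s"
  "tail (channel_graph n s) = fst"
  "head (channel_graph n s) = snd"
  by (auto simp: channel_graph_def channel_arcs_def)

lemma finite_channel_arcs: "finite (channel_arcs n s)"
  by (rule finite_subset[of _ "{..<n} \<times> {..<n}"]) (auto simp: channel_arcs_def)

lemma strategy_combsD:
  assumes "s \<in> strategy_combs n" "u < n"
  shows "s u \<subseteq> {..<n} - {u}"
  using assms by (auto simp: strategy_combs_def strategy_set_def PiE_iff)

lemma channel_arcs_irrefl: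
  assumes "s \<in> strategy_combs n" "(u, v) \<in> channel_arcs n s"
  shows "u \<noteq> v"
  using assms strategy_combsD[of s n] by (auto simp: channel_arcs_def)

lemma awalk_single:
  assumes "(u, v) \<in> channel_arcs n s"
  shows "pre_digraph.awalk (channel_graph n s) u [(u, v)] v"
  using assms by (auto simp: pre_digraph.awalk_def pre_digraph.cas.simps channel_arcs_def)

lemma awalk_cost_one:
  fixes p :: "(nat \<times> nat) awalk"
  shows "wf_digraph.awalk_cost (\<lambda>_. 1) p = real (length p)"
  by (simp add: wf_digraph.awalk_cost_def[OF wf_digraph_channel_graph] sum_list_triv)

lemma graph_dist_adjacent_le_1:
  assumes "(u, v) \<in> channel_arcs n s"
  shows "graph_dist (channel_graph n s) u v \<le> 1"
  using wf_digraph.min_cost_le_walk_cost[OF wf_digraph_channel_graph awalk_single[OF assms], of "\<lambda>_. 1"]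
  by (simp add: graph_dist_def awalk_cost_one one_ereal_def)

lemma graph_dist_ge_1:
  assumes "u \<noteq> v"
  shows "1 \<le> graph_dist (channel_graph n s) u v"
  unfolding graph_dist_def wf_digraph.\<mu>_def[OF wf_digraph_channel_graph]
proof (rule INF_greatest, clarify)
  fix p assume "pre_digraph.awalk (channel_graph n s) u p v"
  with assms have "p \<noteq> []"
    by (auto simp: pre_digraph.awalk_def pre_digraph.cas.simps)
  then have "1 \<le> real (length p)"
    by (cases p) auto
  then show "1 \<le> ereal (wf_digraph.awalk_cost (\<lambda>_. 1) p)"
    by (simp add: awalk_cost_one one_ereal_def)
qed

text \<open>The empty walk does not reach \<open>v\<close>, and a nonempty one would begin with an
  arc leaving \<open>u\<close>. So the infimum defining the distance runs over the empty
  set.\<close>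

lemma graph_dist_isolated:
  assumes "u \<noteq> v" "\<And>w. (u, w) \<notin> channel_arcs n s"
  shows "graph_dist (channel_graph n s) u v = \<infinity>"
proof -
  have "{p. pre_digraph.awalk (channel_graph n s) u p v} = {}"
  proof (safe)
    fix p assume "pre_digraph.awalk (channel_graph n s) u p v"
    with assms show "p \<in> {}"
      by (cases p) (auto simp: pre_digraph.awalk_def pre_digraph.cas.simps)
  qed
  then show ?thesis
    by (simp add: graph_dist_def wf_digraph.\<mu>_def[OF wf_digraph_channel_graph] top_ereal_def)
qed

text \<open>The arc itself is a walk of length \<open>1\<close>, hence a shortest path is a single
  arc and has no interior vertex.\<close>

lemma shortest_paths_via_adjacent:
  assumes "(i, j) \<in> channel_arcs n s" "i \<noteq> j" "u \<noteq> i" "u \<noteq> j"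
  shows "shortest_paths_via (channel_graph n s) u i j = {}"
proof -
  have "u \<notin> set (pre_digraph.awalk_verts (channel_graph n s) i p)"
    if "p \<in> shortest_paths (channel_graph n s) i j" for p
  proof -
    from that have walk: "pre_digraph.awalk (channel_graph n s) i p j"
      and "ereal (real (length p)) = graph_dist (channel_graph n s) i j"
      by (auto simp: shortest_paths_def pre_digraph.apath_def)
    then have "ereal (real (length p)) \<le> 1"
      using graph_dist_adjacent_le_1[OF assms(1)] by simp
    then have "length p \<le> 1"
      by (simp add: one_ereal_def)
    moreover have "p \<noteq> []"
      using walk assms(2) by (auto simp: pre_digraph.awalk_def pre_digraph.cas.simps)
    ultimately obtain e where "p = [e]"
      by (cases p) auto
    with walk assms show ?thesis
      by (auto simp: pre_digraph.awalk_def pre_digraph.cas.simps pre_digraph.awalk_verts.simps)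
  qed
  then show ?thesis
    by (auto simp: shortest_paths_via_def)
qed

section \<open>Lower bound on betweenness\<close>

definition other_pairs :: "nat \<Rightarrow> nat \<Rightarrow> (nat \<times> nat) set" where
  "other_pairs n u = {(i, j). i < n \<and> j < n \<and> i \<noteq> j \<and> i \<noteq> u \<and> j \<noteq> u}"

lemma finite_other_pairs: "finite (other_pairs n u)"
  by (rule finite_subset[of _ "{..<n} \<times> {..<n}"]) (auto simp: other_pairs_def)

text \<open>Identifies the constant in \<open>betweenness\<close> as the number of pairs that the
  subtracted sum would range over if every pair were joined by a path.\<close>

lemma card_other_pairs:
  assumes "u < n" "n \<ge> 2"
  shows "real (card (other_pairs n u)) = (real n - 1) * (real n - 2)"
proof -
  have "other_pairs n u = (SIGMA i:{..<n} - {u}. {..<n} - {u, i})"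
    by (auto simp: other_pairs_def)
  then have "card (other_pairs n u) = (\<Sum>i\<in>{..<n} - {u}. card ({..<n} - {u, i}))"
    by simp
  also have "\<dots> = (\<Sum>i\<in>{..<n} - {u}. n - 2)"
    using assms by (intro sum.cong) (auto simp: card_Diff_subset)
  also have "\<dots> = (n - 1) * (n - 2)"
    using assms by simp
  finally show ?thesis
    using assms by (simp add: of_nat_diff)
qed

lemma betweenness_le: "betweenness n s u \<le> (real n - 1) * (real n - 2)"
  unfolding betweenness_def by (auto intro!: sum_nonneg)

text \<open>Every pair avoiding \<open>u\<close> contributes at most \<open>1\<close> to the
  subtracted sum and every adjacent pair contributes \<open>0\<close>. So each arc avoiding
  \<open>u\<close> leaves one unit of the constant \<open>(n - 1) (n - 2)\<close> in place.\<close>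

lemma betweenness_ge:
  assumes "s \<in> strategy_combs n" "u < n" "n \<ge> 2"
  shows "real (card {e \<in> channel_arcs n s. fst e \<noteq> u \<and> snd e \<noteq> u}) \<le> betweenness n s u"
proof -
  let ?G = "channel_graph n s"
  let ?A = "{e \<in> channel_arcs n s. fst e \<noteq> u \<and> snd e \<noteq> u}"
  let ?P = "{(i, j). i < n \<and> j < n \<and> i \<noteq> j \<and> i \<noteq> u \<and> j \<noteq> u \<and> card (shortest_paths ?G i j) > 0}"
  let ?r = "\<lambda>(i, j). real (card (shortest_paths_via ?G u i j)) / real (card (shortest_paths ?G i j))"
  have sub: "?A \<subseteq> other_pairs n u" "?P \<subseteq> other_pairs n u"
    using channel_arcs_irrefl[OF assms(1)] by (auto simp: other_pairs_def channel_arcs_def)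
  have r1: "?r e \<le> 1" if "e \<in> ?P" for e
  proof -
    obtain i j where e: "e = (i, j)" by force
    with that have pos: "card (shortest_paths ?G i j) > 0" by auto
    \<comment> \<open>An infinite set has cardinality \<open>0\<close>, so the positivity required
      by the index set yields the finiteness that \<open>card_mono\<close> needs.\<close>
    then have "finite (shortest_paths ?G i j)" by (rule card_ge_0_finite)
    then have "card (shortest_paths_via ?G u i j) \<le> card (shortest_paths ?G i j)"
      by (rule card_mono) (auto simp: shortest_paths_via_def)
    with pos e show ?thesis by (simp add: divide_le_eq_1)
  qed
  have r0: "?r e = 0" if "e \<in> ?A" for e
    using that channel_arcs_irrefl[OF assms(1)]
    by (cases e) (auto simp: shortest_paths_via_adjacent)
  have "sum ?r ?P = sum ?r (?P - ?A)"
  proof (rule sum.mono_neutral_right)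
    show "finite ?P"
      using sub(2) finite_other_pairs by (rule finite_subset)
    show "\<forall>e\<in>?P - (?P - ?A). ?r e = 0"
      using r0 by blast
  qed (rule Diff_subset)
  also have "\<dots> \<le> (\<Sum>e\<in>?P - ?A. 1)"
    using r1 by (intro sum_mono) blast
  also have "\<dots> \<le> real (card (other_pairs n u - ?A))"
  proof -
    have "card (?P - ?A) \<le> card (other_pairs n u - ?A)"
      using sub(2) by (intro card_mono) (auto simp: finite_other_pairs)
    then show ?thesis by simp
  qed
  also have "\<dots> = real (card (other_pairs n u)) - real (card ?A)"
    using sub(1) finite_other_pairs
    by (subst card_Diff_subset) (auto intro: finite_subset simp: of_nat_diff card_mono)
  finally show ?thesis
    unfolding betweenness_def card_other_pairs[OF assms(2,3)] by linarith
qed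

text \<open>Double counting of the pairs of a player and an arc avoiding that player: the two ends
  of an arc are distinct, so it avoids exactly \<open>n - 2\<close> players.\<close>

lemma sum_betweenness_ge:
  assumes "s \<in> strategy_combs n" "n \<ge> 2"
  shows "(real n - 2) * real (card (channel_arcs n s)) \<le> (\<Sum>u<n. betweenness n s u)"
proof -
  let ?R = "\<lambda>u e. fst e \<noteq> u \<and> snd e \<noteq> u"
  have "card {u \<in> {..<n}. ?R u e} = n - 2" if "e \<in> channel_arcs n s" for e
  proof -
    obtain i j where e: "e = (i, j)" by force
    have "{u \<in> {..<n}. ?R u e} = {..<n} - {i, j}"
      using e by auto
    moreover have "i < n" "j < n" "i \<noteq> j"
      using that e channel_arcs_irrefl[OF assms(1)] by (auto simp: channel_arcs_def)
    ultimately show ?thesis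
      by (simp add: card_Diff_subset)
  qed
  then have "(\<Sum>u\<in>{..<n}. card {e \<in> channel_arcs n s. ?R u e}) = (n - 2) * card (channel_arcs n s)"
    using sum_multicount[OF finite_lessThan finite_channel_arcs, where R = ?R] by blast
  then have "real ((n - 2) * card (channel_arcs n s))
      = (\<Sum>u<n. real (card {e \<in> channel_arcs n s. ?R u e}))"
    by (simp only: of_nat_sum[symmetric])
  also have "\<dots> \<le> (\<Sum>u<n. betweenness n s u)"
    using assms by (intro sum_mono betweenness_ge) auto
  finally show ?thesis
    using assms by (simp add: of_nat_diff)
qed

section \<open>Lower bound on the social cost\<close>

lemma card_channel_arcs_le:
  assumes "s \<in> strategy_combs n"
  shows "card (channel_arcs n s) \<le> 2 * (\<Sum>u<n. card (s u))"
proof -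
  let ?S = "SIGMA u:{..<n}. s u"
  have fin: "finite (s u)" if "u < n" for u
    using strategy_combsD[OF assms that] finite_subset by blast
  then have finS: "finite ?S" by auto
  \<comment> \<open>An arc is an opened channel read in one of its two directions; a channel opened
    from both ends only makes the inequality strict.\<close>
  have "channel_arcs n s \<subseteq> ?S \<union> prod.swap ` ?S"
    by (force simp: channel_arcs_def image_iff)
  then have "card (channel_arcs n s) \<le> card (?S \<union> prod.swap ` ?S)"
    using finS by (intro card_mono) auto
  also have "\<dots> \<le> card ?S + card (prod.swap ` ?S)"
    by (rule card_Un_le)
  also have "\<dots> \<le> 2 * card ?S"
    using card_image_le[OF finS, of prod.swap] by simp
  also have "card ?S = (\<Sum>u<n. card (s u))"
    using fin by simp
  finally show ?thesis .
qed

lemma closeness_nonneg: "0 \<le> closeness n s u"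
  unfolding closeness_def
  using graph_dist_ge_1 by (intro sum_nonneg) (auto simp: ereal_diff_positive)

lemma closeness_isolated:
  assumes "u < n" "n \<ge> 2" "\<And>w. (u, w) \<notin> channel_arcs n s"
  shows "closeness n s u = \<infinity>"
proof -
  \<comment> \<open>As \<open>n \<ge> 2\<close>, one of the players \<open>0\<close> and
    \<open>1\<close> differs from \<open>u\<close>; a single infinite summand suffices.\<close>
  define v :: nat where "v = (if u = 0 then 1 else 0)"
  have "v \<in> {..<n} - {u}"
    using assms by (auto simp: v_def)
  moreover from this have "graph_dist (channel_graph n s) u v - 1 = \<infinity>"
    using graph_dist_isolated[OF _ assms(3), of v] by auto
  ultimately show ?thesis
    unfolding closeness_def by (subst sum_Pinfty) auto
qed

text \<open>The closeness term is nonnegative but possibly infinite. Dropping it leaves a real bound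
  that can be summed by real arithmetic.\<close>

lemma player_cost_ge:
  assumes "c > 0"
  shows "ereal (real (card (s u)) + b * betweenness n s u) \<le> player_cost n b c s u"
proof -
  have "0 \<le> ereal c * closeness n s u"
    using assms closeness_nonneg by simp
  then show ?thesis
    unfolding player_cost_def by (simp add: add_increasing2)
qed

lemma social_cost_ge:
  assumes "s \<in> strategy_combs n" "n \<ge> 2" "b \<ge> 0" "c > 0"
  shows "ereal (real n / 2 + b * (real n * (real n - 2))) \<le> social_cost n b c s"
\<comment> \<open>An isolated player has infinite cost. Without isolated players the real bound
  below holds even if the graph is disconnected.\<close>
proof (cases "\<exists>u<n. \<forall>w. (u, w) \<notin> channel_arcs n s")
  case True
  then obtain u where u: "u < n" "\<And>w. (u, w) \<notin> channel_arcs n s" by auto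
  have "player_cost n b c s u = \<infinity>"
    using assms(4) by (simp add: player_cost_def closeness_isolated[OF u(1) assms(2) u(2)])
  then have "social_cost n b c s = \<infinity>"
    unfolding social_cost_def using u(1) by (subst sum_Pinfty) auto
  then show ?thesis by simp
next
  case False
  then have "{..<n} \<subseteq> fst ` channel_arcs n s" by force
  then have "card {..<n} \<le> card (channel_arcs n s)"
    by (rule surj_card_le[OF finite_channel_arcs])
  then have arcs: "real n \<le> real (card (channel_arcs n s))" by simp
  have "real (card (channel_arcs n s)) \<le> 2 * (\<Sum>u<n. real (card (s u)))"
    using card_channel_arcs_le[OF assms(1)] by (metis of_nat_le_iff of_nat_mult of_nat_numeral of_nat_sum)
  with arcs have edges: "real n / 2 \<le> (\<Sum>u<n. real (card (s u)))" by simp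
  have "real n * (real n - 2) \<le> (real n - 2) * real (card (channel_arcs n s))"
    using mult_left_mono[OF arcs, of "real n - 2"] assms(2) by (simp add: mult.commute)
  also note sum_betweenness_ge[OF assms(1,2)]
  finally have "b * (real n * (real n - 2)) \<le> b * (\<Sum>u<n. betweenness n s u)"
    using assms(3) by (rule mult_left_mono)
  with edges have "real n / 2 + b * (real n * (real n - 2))
      \<le> (\<Sum>u<n. real (card (s u)) + b * betweenness n s u)"
    by (simp add: sum.distrib sum_distrib_left)
  then have "ereal (real n / 2 + b * (real n * (real n - 2)))
      \<le> (\<Sum>u<n. ereal (real (card (s u)) + b * betweenness n s u))"
    by simp
  also have "\<dots> \<le> social_cost n b c s"
    unfolding social_cost_def using assms(4) by (intro sum_mono player_cost_ge)
  finally show ?thesis .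
qed

section \<open>Upper bound on the social cost of an equilibrium\<close>

lemma player_cost_open_all_le:
  assumes "u < n" "b \<ge> 0" "c > 0"
  shows "player_cost n b c (s(u := {..<n} - {u})) u
    \<le> ereal ((real n - 1) + b * ((real n - 1) * (real n - 2)))"
proof -
  let ?s = "s(u := {..<n} - {u})"
  \<comment> \<open>All other players are now adjacent to \<open>u\<close>, so no summand of the
    closeness is positive, and with \<open>closeness_nonneg\<close> the closeness vanishes.\<close>
  have "graph_dist (channel_graph n ?s) u v - 1 \<le> 0" if "v \<in> {..<n} - {u}" for v
    using that assms(1) graph_dist_adjacent_le_1[of u v n ?s]
    by (simp add: channel_arcs_def ereal_minus_le_iff one_ereal_def)
  then have "closeness n ?s u \<le> 0"
    unfolding closeness_def by (rule sum_nonpos)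
  with closeness_nonneg[of n ?s u] have "closeness n ?s u = 0"
    by (rule antisym[rotated])
  moreover have "b * betweenness n ?s u \<le> b * ((real n - 1) * (real n - 2))"
    using betweenness_le assms(2) by (rule mult_left_mono)
  ultimately show ?thesis
    using assms(1) by (simp add: player_cost_def of_nat_diff)
qed

lemma social_cost_nash_le:
  assumes "s \<in> nash_equilibria n b c" "b \<ge> 0" "c > 0"
  shows "social_cost n b c s \<le> ereal (real n * ((real n - 1) + b * ((real n - 1) * (real n - 2))))"
proof -
  have "player_cost n b c s u \<le> ereal ((real n - 1) + b * ((real n - 1) * (real n - 2)))"
    if "u < n" for u
  proof -
    have "{..<n} - {u} \<in> strategy_set n u"
      by (simp add: strategy_set_def)
    then have "player_cost n b c s u \<le> player_cost n b c (s(u := {..<n} - {u})) u"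
      using assms(1) that by (auto simp: nash_equilibria_def not_less)
    also note player_cost_open_all_le[OF that assms(2,3)]
    finally show ?thesis .
  qed
  then have "social_cost n b c s
      \<le> (\<Sum>u<n. ereal ((real n - 1) + b * ((real n - 1) * (real n - 2))))"
    unfolding social_cost_def by (intro sum_mono) auto
  then show ?thesis by simp
qed

section \<open>The optimum and the ratio\<close>

lemma social_optimum_ge:
  assumes "n \<ge> 2" "b \<ge> 0" "c > 0"
  shows "ereal (real n / 2 + b * (real n * (real n - 2))) \<le> social_optimum n b c"
proof -
  \<comment> \<open>A bound on \<open>Min\<close> requires a nonempty set; the combination in which
    nobody opens a channel provides a member.\<close>
  have "(\<lambda>u\<in>{..<n}. {}) \<in> strategy_combs n"
    by (auto simp: strategy_combs_def strategy_set_def)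
  then show ?thesis
    unfolding social_optimum_def using assms
    by (intro Min.boundedI) (auto simp: finite_strategy_combs social_cost_ge)
qed

theorem theorem10:
  shows "\<exists>C::real. \<forall>(n::nat) (b::real) (c::real).
           n \<ge> 2 \<longrightarrow> b \<ge> 0 \<longrightarrow> c > 0 \<longrightarrow> c + b \<ge> 1 / (real n)\<^sup>2 \<longrightarrow> c < 1 \<longrightarrow>
           price_of_anarchy n b c \<le> ereal (C * real n)"
proof (intro exI[of _ 2] allI impI)
  fix n :: nat and b c :: real
  assume n: "n \<ge> 2" and b: "b \<ge> 0" and c: "c > 0"
  let ?L = "real n / 2 + b * (real n * (real n - 2))"
  let ?U = "real n * ((real n - 1) + b * ((real n - 1) * (real n - 2)))"
  \<comment> \<open>The factor \<open>2\<close> comes from the channel terms, \<open>n - 1\<close>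
    against \<open>n / 2\<close>. The betweenness terms fit under the same factor, and the remaining
    factor \<open>n\<close> of \<open>?U\<close> is the number of players.\<close>
  have "(real n - 1) * (real n - 2) \<le> (2 * real n) * (real n - 2)"
    using n by (intro mult_right_mono) auto
  then have "b * ((real n - 1) * (real n - 2)) \<le> b * ((2 * real n) * (real n - 2))"
    using b by (rule mult_left_mono)
  then have "(real n - 1) + b * ((real n - 1) * (real n - 2)) \<le> 2 * ?L"
    by (simp add: algebra_simps)
  then have "?U \<le> real n * (2 * ?L)"
    by (rule mult_left_mono) simp
  then have UL: "?U \<le> 2 * real n * ?L"
    by (simp only: ac_simps)
  have L: "?L > 0"
    using n b by (intro add_pos_nonneg) auto
  have opt: "ereal ?L \<le> social_optimum n b c"
    using social_optimum_ge[OF n b c] .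
  show "price_of_anarchy n b c \<le> ereal (2 * real n)"
    unfolding price_of_anarchy_def
  proof (rule SUP_least)
    fix s assume "s \<in> nash_equilibria n b c"
    then have cost: "social_cost n b c s \<le> ereal ?U"
      using social_cost_nash_le b c by blast
    show "social_cost n b c s / social_optimum n b c \<le> ereal (2 * real n)"
    \<comment> \<open>Division by \<open>\<infinity>\<close> gives \<open>0\<close> in
      \<open>ereal\<close>, so finiteness of the optimum need not be established;
      \<open>-\<infinity>\<close> contradicts the bound by \<open>?L\<close>.\<close>
    proof (cases "social_optimum n b c")
      case (real r)
      with opt L have r: "?L \<le> r" "r > 0" by auto
      have "?U \<le> 2 * real n * r"
        using UL mult_left_mono[OF r(1), of "2 * real n"] by linarith
      with cost have "social_cost n b c s \<le> ereal (2 * real n * r)"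
        by (meson ereal_less_eq(3) order_trans)
      with real r(2) show ?thesis
        by (simp add: ereal_divide_le_pos mult.commute)
    next
      case PInf
      then show ?thesis by simp
    next
      case MInf
      with opt show ?thesis by simp
    qed
  qed
qed

end
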